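(* Let $n\ge 1$ and let $U\subset\mathbb{R}^n$ be an open and bounded definable set. Then $U$ is semi-monotone if and only if both of the following conditions hold: (S1) the intersection of $U$ with any line parallel to the $x_n$-axis is either empty or an open interval; (S2) for any $\sigma\in\{<,=,>\}$ and any $c\in\mathbb{R}$, the projection of the set $U\cap\{(x_1,\dots,x_n)\in\mathbb{R}^n : x_n\,\sigma\,c\}$ to $\mathbb{R}^{n-1}$ along the $x_n$-axis is a semi-monotone set in $\mathbb{R}^{n-1}$.
   Context: Fix an o-minimal structure over $\mathbb{R}$; all sets and maps are definable in it. For $1\le j\le n$, $\sigma\in\{<,=,>\}$, $c\in\mathbb{R}$ put $X_{j,\sigma,c}:=\{(x_1,\dots,x_n)\in\mathbb{R}^n : x_j\,\sigma\,c\}$. A (definable) open, possibly empty, bounded set $U\subset\mathbb{R}^n$ is called semi-monotone if $U\cap X_{j_1,\sigma_1,c_1}\cap\cdots\cap X_{j_k,\sigma_k,c_k}$ is connected for any $0\le k\le n$, any $1\le j_1<\dots<j_k\le n$, any $\sigma_1,\dots,\sigma_k\in\{<,=,>\}$ and any $c_1,\dots,c_k\in\mathbb{R}$ (the empty set counts as connected). In $\mathbb{R}^0$ (a point) every subset is semi-monotone. *)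

theory Defs
  imports "HOL-Analysis.Analysis"
begin

text \<open>
  \<open>\<real>\<^sup>n\<close> is \<^const>\<open>Euclidean_space\<close> \<open>n\<close>: its points are the \<open>x :: nat \<Rightarrow> real\<close> with \<open>x i = 0\<close> for
  \<open>i \<ge> n\<close>. Coordinates are numbered from 0, so the mathematical \<open>x\<^sub>j\<close> is \<open>x (j - 1)\<close> and the
  last coordinate of \<open>\<real>\<^sup>n\<close> is \<open>x (n - 1)\<close>.
\<close>

text \<open>The projection \<open>\<real>\<^sup>m\<^sup>+\<^sup>1 \<rightarrow> \<real>\<^sup>m\<close> onto the first \<open>m\<close> coordinates.\<close>

definition proj_first :: "nat \<Rightarrow> (nat \<Rightarrow> real) \<Rightarrow> (nat \<Rightarrow> real)" where
  "proj_first m x = x(m := 0)"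

text \<open>
  An o-minimal structure on the ordered set \<open>(\<real>, <)\<close> in the sense of van den Dries;
  \<open>S n\<close> is the collection of definable subsets of \<open>\<real>\<^sup>n\<close>. Expansions of the real field are a
  special case. The two product axioms are the closure under \<open>A \<mapsto> A \<times> \<real>\<close> and \<open>A \<mapsto> \<real> \<times> A\<close>.
  In the last axiom \<^const>\<open>is_interval\<close> covers singletons and all bounded or unbounded, open,
  closed or half-open intervals, so finite unions of these are exactly the finite unions of
  open intervals and points.
\<close>

locale o_minimal_structure =
  fixes S :: "nat \<Rightarrow> (nat \<Rightarrow> real) set set"
  assumes boolean_algebra: "algebra (topspace (Euclidean_space n)) (S n)"
    and product_right:
      "A \<in> S n \<Longrightarrow> {x \<in> topspace (Euclidean_space (Suc n)). proj_first n x \<in> A} \<in> S (Suc n)"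
    and product_left:
      "A \<in> S n \<Longrightarrow> {x \<in> topspace (Euclidean_space (Suc n)). (\<lambda>i. x (Suc i)) \<in> A} \<in> S (Suc n)"
    and diagonal: "n \<ge> 1 \<Longrightarrow> {x \<in> topspace (Euclidean_space n). x 0 = x (n - 1)} \<in> S n"
    and projection: "A \<in> S (Suc n) \<Longrightarrow> proj_first n ` A \<in> S n"
    and order: "{x \<in> topspace (Euclidean_space 2). x 0 < x 1} \<in> S 2"
    and o_minimal:
      "S 1 = {{x \<in> topspace (Euclidean_space 1). x 0 \<in> \<Union>F} | F :: real set set.
                finite F \<and> (\<forall>I\<in>F. is_interval I)}"

text \<open>\<^const>\<open>L2_set\<close> \<open>x {..<n}\<close> is the Euclidean norm on \<open>\<real>\<^sup>n\<close>.\<close>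

definition bounded_Euclidean :: "nat \<Rightarrow> (nat \<Rightarrow> real) set \<Rightarrow> bool" where
  "bounded_Euclidean n U \<longleftrightarrow> (\<exists>B. \<forall>x\<in>U. L2_set x {..<n} \<le> B)"

definition order_relations :: "(real \<Rightarrow> real \<Rightarrow> bool) set" where
  "order_relations = {(<), (=), (>)}"

definition coord_set :: "nat \<Rightarrow> nat \<Rightarrow> (real \<Rightarrow> real \<Rightarrow> bool) \<Rightarrow> real \<Rightarrow> (nat \<Rightarrow> real) set" where
  "coord_set n j \<sigma> c = {x \<in> topspace (Euclidean_space n). \<sigma> (x j) c}"

text \<open>
  The choice of \<open>k \<le> n\<close> and of indices \<open>j\<^sub>1 < \<dots> < j\<^sub>k\<close> is the choice of a set \<open>J\<close> of coordinates;
  only the values of \<open>\<sigma>\<close> and \<open>c\<close> on \<open>J\<close> matter. The predicate \<^const>\<open>connectedin\<close> holds of the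
  empty set. For o-minimal \<open>S\<close> and \<open>n = 0\<close> the definition holds of both subsets of the point \<open>\<real>\<^sup>0\<close>.
\<close>

definition semi_monotone ::
    "(nat \<Rightarrow> (nat \<Rightarrow> real) set set) \<Rightarrow> nat \<Rightarrow> (nat \<Rightarrow> real) set \<Rightarrow> bool" where
  "semi_monotone S n U \<longleftrightarrow>
     U \<in> S n \<and> openin (Euclidean_space n) U \<and> bounded_Euclidean n U \<and>
     (\<forall>J \<sigma> c. J \<subseteq> {..<n} \<longrightarrow> (\<forall>j\<in>J. \<sigma> j \<in> order_relations) \<longrightarrow>
        connectedin (Euclidean_space n) (U \<inter> (\<Inter>j\<in>J. coord_set n j (\<sigma> j) (c j))))"

text \<open>The line through \<open>a\<close> parallel to the last coordinate axis of \<open>\<real>\<^sup>n\<close>, for \<open>n \<ge> 1\<close>.\<close>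

definition vertical_line :: "nat \<Rightarrow> (nat \<Rightarrow> real) \<Rightarrow> (nat \<Rightarrow> real) set" where
  "vertical_line n a = range (\<lambda>t. a(n - 1 := t))"

text \<open>
  Stated for bounded \<open>U\<close>, so the open interval of the line has two finite endpoints.
\<close>

definition vertical_sections_intervals :: "nat \<Rightarrow> (nat \<Rightarrow> real) set \<Rightarrow> bool" where
  "vertical_sections_intervals n U \<longleftrightarrow>
     (\<forall>a \<in> topspace (Euclidean_space n).
        U \<inter> vertical_line n a = {} \<or>
        (\<exists>s t. s < t \<and> U \<inter> vertical_line n a = (\<lambda>r. a(n - 1 := r)) ` {s<..<t}))"

end

theory Submission
  imports Defs
begin

text \<open>
  Let \<open>p : \<real>\<^sup>m\<^sup>+\<^sup>1 \<rightarrow> \<real>\<^sup>m\<close> forget the last coordinate \<open>x\<^sub>m\<close>, and let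
  \<open>W = U \<inter> {x\<^sub>m \<sigma> c}\<close>. Two facts about \<open>p\<close> on \<open>W\<close> carry the proof.

  Every relatively open subset of \<open>W\<close> is \<open>V \<inter> {x\<^sub>m \<sigma> c}\<close> with \<open>V\<close> open, and its projection is the
  union of the horizontal slices of \<open>V\<close> at the heights \<open>t\<close> with \<open>t \<sigma> c\<close>. Slices of open sets
  are open, so \<open>p\<close> is an open map on \<open>W\<close>, also when \<open>\<sigma>\<close> is equality and \<open>W\<close> is not open
  (\<open>openin_proj_first_coord_set\<close>).

  If \<open>U\<close> satisfies (S1), the fibres of \<open>p\<close> on \<open>W\<close> are intervals, hence connected. A continuous open
  surjection with connected fibres pulls connected sets back to connected sets, so the
  connectedness of \<open>p(W) \<inter> X\<close>, for an intersection \<open>X\<close> of coordinate conditions not involving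
  \<open>x\<^sub>m\<close>, gives that of \<open>W \<inter> p\<^sup>-\<^sup>1(X)\<close> (\<open>connectedin_lift_from_projection\<close>). The converse
  implication holds because continuous images of connected sets are connected.

  Thus (S1) and (S2) control exactly those intersections which involve \<open>x\<^sub>m\<close>. The others are of
  the same kind: \<open>U\<close> is bounded, so imposing \<open>x\<^sub>m < c\<close> for a large \<open>c\<close> changes nothing. Conversely
  (S1) is the instance of semi-monotonicity that fixes all coordinates but the last. The o-minimal
  structure enters only through the definability of the projections.
\<close>

section \<open>Continuity and openness of the coordinate projection\<close>

lemma continuous_map_into_Euclidean_space:
  assumes "\<And>i. continuous_map X euclideanreal (\<lambda>x. f x i)"
    and "\<And>x. x \<in> topspace X \<Longrightarrow> f x \<in> topspace (Euclidean_space n)"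
  shows "continuous_map X (Euclidean_space n) f"
  using assms unfolding Euclidean_space_def continuous_map_in_subtopology
  by (auto simp: continuous_map_componentwise_UNIV)

lemma continuous_map_Euclidean_coordinate:
  "continuous_map (Euclidean_space n) euclideanreal (\<lambda>x. x i)"
  unfolding Euclidean_space_def
  by (intro continuous_map_from_subtopology continuous_map_product_coordinates) auto

lemma continuous_map_proj_first:
  "continuous_map (Euclidean_space (Suc m)) (Euclidean_space m) (proj_first m)"
proof (rule continuous_map_into_Euclidean_space)
  show "continuous_map (Euclidean_space (Suc m)) euclideanreal (\<lambda>x. proj_first m x i)" for i
    by (cases "i = m") (simp_all add: proj_first_def continuous_map_Euclidean_coordinate)
qed (auto simp: proj_first_def topspace_Euclidean_space)

lemma continuous_map_slice:
  "continuous_map (Euclidean_space m) (Euclidean_space (Suc m)) (\<lambda>y. y(m := t))"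
proof (rule continuous_map_into_Euclidean_space)
  show "continuous_map (Euclidean_space m) euclideanreal (\<lambda>y. (y(m := t)) i)" for i
    by (cases "i = m") (simp_all add: continuous_map_Euclidean_coordinate)
qed (auto simp: topspace_Euclidean_space)

lemma continuous_map_vertical_line:
  assumes "a \<in> topspace (Euclidean_space (Suc m))"
  shows "continuous_map euclideanreal (Euclidean_space (Suc m)) (\<lambda>r. a(m := r))"
proof (rule continuous_map_into_Euclidean_space)
  show "continuous_map euclideanreal euclideanreal (\<lambda>r. (a(m := r)) i)" for i
    by (cases "i = m") simp_all
qed (use assms in \<open>auto simp: topspace_Euclidean_space\<close>)

lemma proj_first_coord_set_eq_Union_slices:
  assumes "V \<subseteq> topspace (Euclidean_space (Suc m))"
  shows "proj_first m ` (V \<inter> coord_set (Suc m) m \<sigma> c) =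
           (\<Union>t\<in>{t. \<sigma> t c}. {y \<in> topspace (Euclidean_space m). y(m := t) \<in> V})"
proof (intro equalityI subsetI)
  fix y assume "y \<in> proj_first m ` (V \<inter> coord_set (Suc m) m \<sigma> c)"
  then obtain x where x: "x \<in> V" "\<sigma> (x m) c" "x \<in> topspace (Euclidean_space (Suc m))"
    "y = x(m := 0)"
    by (auto simp: coord_set_def proj_first_def)
  then have "y \<in> topspace (Euclidean_space m)" "y(m := x m) \<in> V"
    by (auto simp: topspace_Euclidean_space)
  with x show "y \<in> (\<Union>t\<in>{t. \<sigma> t c}. {y \<in> topspace (Euclidean_space m). y(m := t) \<in> V})"
    by blast
next
  fix y assume "y \<in> (\<Union>t\<in>{t. \<sigma> t c}. {y \<in> topspace (Euclidean_space m). y(m := t) \<in> V})"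
  then obtain t where t: "\<sigma> t c" "y \<in> topspace (Euclidean_space m)" "y(m := t) \<in> V" by blast
  then have "proj_first m (y(m := t)) = y"
    by (auto simp: proj_first_def topspace_Euclidean_space)
  moreover have "y(m := t) \<in> V \<inter> coord_set (Suc m) m \<sigma> c"
    using t assms by (auto simp: coord_set_def)
  ultimately show "y \<in> proj_first m ` (V \<inter> coord_set (Suc m) m \<sigma> c)"
    by (metis imageI)
qed

text \<open>
  Each slice is the preimage of \<open>V\<close> under the continuous map \<open>y \<mapsto> (y, t)\<close>. Arguing slice by slice
  treats \<open>x\<^sub>m = c\<close>, where the set to be projected has empty interior, like the two strict
  inequalities.
\<close>

lemma openin_proj_first_coord_set:
  assumes "openin (Euclidean_space (Suc m)) V"
  shows "openin (Euclidean_space m) (proj_first m ` (V \<inter> coord_set (Suc m) m \<sigma> c))"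
  unfolding proj_first_coord_set_eq_Union_slices[OF openin_subset[OF assms]]
  by (intro openin_Union ballI)
    (auto intro: openin_continuous_map_preimage[OF continuous_map_slice assms])

lemma open_map_proj_first_coord_set:
  assumes "openin (Euclidean_space (Suc m)) U"
  shows "open_map (subtopology (Euclidean_space (Suc m)) (U \<inter> coord_set (Suc m) m \<sigma> c))
           (Euclidean_space m) (proj_first m)"
  unfolding open_map_def
proof (intro allI impI)
  fix A
  assume "openin (subtopology (Euclidean_space (Suc m)) (U \<inter> coord_set (Suc m) m \<sigma> c)) A"
  then obtain V where V: "openin (Euclidean_space (Suc m)) V"
    "A = V \<inter> (U \<inter> coord_set (Suc m) m \<sigma> c)"
    by (auto simp: openin_subtopology)
  then have "A = (V \<inter> U) \<inter> coord_set (Suc m) m \<sigma> c" by blast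
  then show "openin (Euclidean_space m) (proj_first m ` A)"
    using openin_proj_first_coord_set[OF openin_Int[OF V(1) assms]] by simp
qed

section \<open>Lifting connectedness along vertical intervals\<close>

lemma is_interval_order_relation:
  assumes "\<sigma> \<in> order_relations"
  shows "is_interval {r. \<sigma> r (c::real)}"
  using assms by (auto simp: order_relations_def is_interval_1)

text \<open>
  A fibre of the projection consists of the points of a vertical section whose height lies in the
  interval \<open>{r. r \<sigma> c}\<close>; two intervals intersect in an interval.
\<close>

lemma connectedin_fibre_proj_first:
  assumes sections: "vertical_sections_intervals (Suc m) U" and "\<sigma> \<in> order_relations"
    and y: "y \<in> topspace (Euclidean_space m)"
  shows "connectedin (Euclidean_space (Suc m))
           {x \<in> U \<inter> coord_set (Suc m) m \<sigma> c. proj_first m x = y}"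
proof -
  have y': "y \<in> topspace (Euclidean_space (Suc m))" and "y m = 0"
    using y by (auto simp: topspace_Euclidean_space)
  then have line: "proj_first m x = y \<longleftrightarrow> x \<in> vertical_line (Suc m) y" for x
    by (auto simp: vertical_line_def proj_first_def image_iff fun_eq_iff)
  have "U \<inter> vertical_line (Suc m) y = {} \<or>
      (\<exists>s t. U \<inter> vertical_line (Suc m) y = (\<lambda>r. y(m := r)) ` {s<..<t})"
    using sections y' unfolding vertical_sections_intervals_def by fastforce
  then obtain s t where st: "U \<inter> vertical_line (Suc m) y = (\<lambda>r. y(m := r)) ` {s<..<t}"
    by (metis greaterThanLessThan_empty image_empty order_refl)
  have "{x \<in> U \<inter> coord_set (Suc m) m \<sigma> c. proj_first m x = y} =
      (\<lambda>r. y(m := r)) ` {s<..<t} \<inter> coord_set (Suc m) m \<sigma> c"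
    using line st by blast
  also have "\<dots> = (\<lambda>r. y(m := r)) ` ({s<..<t} \<inter> {r. \<sigma> r c})"
    using y' by (auto simp: coord_set_def topspace_Euclidean_space)
  moreover have "connected ({s<..<t} \<inter> {r. \<sigma> r c})"
    using is_interval_order_relation[OF assms(2)] is_interval_oo
    by (intro is_interval_connected is_interval_Int)
  ultimately show ?thesis
    using connectedin_continuous_map_image[OF continuous_map_vertical_line[OF y']]
    by simp
qed

text \<open>
  Openness is what makes the lifting work: a separation of the preimage of \<open>C\<close> would consist of
  whole fibres, and its two parts would then project to disjoint open subsets covering \<open>C\<close>.
\<close>

lemma connectedin_lift_from_projection:
  assumes "openin (Euclidean_space (Suc m)) U" and "vertical_sections_intervals (Suc m) U"
    and "\<sigma> \<in> order_relations"
    and C: "connectedin (Euclidean_space m) C"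
      "C \<subseteq> proj_first m ` (U \<inter> coord_set (Suc m) m \<sigma> c)"
  shows "connectedin (Euclidean_space (Suc m))
           {x \<in> U \<inter> coord_set (Suc m) m \<sigma> c. proj_first m x \<in> C}"
proof -
  let ?W = "U \<inter> coord_set (Suc m) m \<sigma> c"
  let ?X = "subtopology (Euclidean_space (Suc m)) ?W"
  let ?Y = "subtopology (Euclidean_space m) (proj_first m ` ?W)"
  have X: "topspace ?X = ?W"
    using openin_subset[OF assms(1)] by auto
  have sub: "proj_first m ` ?W \<subseteq> topspace (Euclidean_space m)"
    using openin_subset[OF openin_proj_first_coord_set[OF assms(1)]] .
  then have Y: "topspace ?Y = proj_first m ` ?W" by auto
  have "continuous_map ?X ?Y (proj_first m)"
    using X by (auto simp: continuous_map_in_subtopology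
        intro: continuous_map_from_subtopology continuous_map_proj_first)
  moreover have "open_map ?X ?Y (proj_first m)"
    using X by (intro open_map_into_subtopology open_map_proj_first_coord_set assms(1)) auto
  moreover have "monotone_map ?X ?Y (proj_first m)"
    unfolding monotone_map_def X Y
    using sub connectedin_fibre_proj_first[OF assms(2,3)]
    by (auto simp: connectedin_subtopology)
  ultimately have "\<forall>C. connectedin ?Y C \<longrightarrow> connectedin ?X {x \<in> topspace ?X. proj_first m x \<in> C}"
    using monotone_open_map[of ?X ?Y "proj_first m"] unfolding X Y by blast
  moreover have "connectedin ?Y C" using C by (simp add: connectedin_subtopology)
  ultimately have "connectedin ?X {x \<in> ?W. proj_first m x \<in> C}" unfolding X by blast
  then show ?thesis unfolding connectedin_subtopology by blast
qed

section \<open>Coordinate conditions and projections\<close>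

lemma proj_first_mem_coord_set:
  assumes "x \<in> topspace (Euclidean_space (Suc m))" "j < m"
  shows "proj_first m x \<in> coord_set m j \<sigma> c \<longleftrightarrow> x \<in> coord_set (Suc m) j \<sigma> c"
proof -
  have "proj_first m x \<in> topspace (Euclidean_space m)"
    using assms(1) by (auto simp: proj_first_def topspace_Euclidean_space)
  then show ?thesis using assms by (simp add: coord_set_def proj_first_def)
qed

lemma lift_Inter_coord_set:
  assumes "J \<subseteq> {..<m}" "A \<subseteq> topspace (Euclidean_space (Suc m))"
  shows "{x \<in> A. proj_first m x \<in> proj_first m ` A \<inter> (\<Inter>j\<in>J. coord_set m j (\<sigma> j) (c j))} =
         A \<inter> (\<Inter>j\<in>J. coord_set (Suc m) j (\<sigma> j) (c j))"
    and "proj_first m ` (A \<inter> (\<Inter>j\<in>J. coord_set (Suc m) j (\<sigma> j) (c j))) =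
         proj_first m ` A \<inter> (\<Inter>j\<in>J. coord_set m j (\<sigma> j) (c j))"
proof -
  have iff: "proj_first m x \<in> (\<Inter>j\<in>J. coord_set m j (\<sigma> j) (c j)) \<longleftrightarrow>
      x \<in> (\<Inter>j\<in>J. coord_set (Suc m) j (\<sigma> j) (c j))" if "x \<in> A" for x
    unfolding INT_iff using proj_first_mem_coord_set[of x m] assms that by blast
  then show "{x \<in> A. proj_first m x \<in> proj_first m ` A \<inter> (\<Inter>j\<in>J. coord_set m j (\<sigma> j) (c j))} =
         A \<inter> (\<Inter>j\<in>J. coord_set (Suc m) j (\<sigma> j) (c j))"
    by blast
  show "proj_first m ` (A \<inter> (\<Inter>j\<in>J. coord_set (Suc m) j (\<sigma> j) (c j))) =
         proj_first m ` A \<inter> (\<Inter>j\<in>J. coord_set m j (\<sigma> j) (c j))"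
    using iff by blast
qed

text \<open>
  The half-lines and points of \<open>\<real>\<close> are definable with arbitrary real parameters; multiplying them
  by \<open>\<real>\<close> from the left turns the condition on the only coordinate into one on the last coordinate.
\<close>

lemma (in o_minimal_structure) coord_set_definable:
  assumes "\<sigma> \<in> order_relations"
  shows "coord_set (Suc m) m \<sigma> c \<in> S (Suc m)"
proof (induction m)
  case 0
  have "coord_set 1 0 \<sigma> c = {x \<in> topspace (Euclidean_space 1). x 0 \<in> \<Union>{{r. \<sigma> r c}}}"
    by (simp add: coord_set_def)
  moreover have "finite {{r. \<sigma> r c}}" "\<forall>I\<in>{{r. \<sigma> r c}}. is_interval I"
    using is_interval_order_relation[OF assms] by auto
  ultimately show ?case
    unfolding One_nat_def[symmetric] o_minimal by blast
next
  case (Suc m)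
  have "coord_set (Suc (Suc m)) (Suc m) \<sigma> c =
      {x \<in> topspace (Euclidean_space (Suc (Suc m))). (\<lambda>i. x (Suc i)) \<in> coord_set (Suc m) m \<sigma> c}"
    by (auto simp: coord_set_def topspace_Euclidean_space)
  then show ?case using product_left[OF Suc.IH] by simp
qed

lemma bounded_Euclidean_mono: "bounded_Euclidean n U \<Longrightarrow> V \<subseteq> U \<Longrightarrow> bounded_Euclidean n V"
  unfolding bounded_Euclidean_def by blast

lemma bounded_Euclidean_coordinate:
  assumes "bounded_Euclidean n U" "i < n"
  obtains B where "\<And>x. x \<in> U \<Longrightarrow> \<bar>x i\<bar> \<le> B"
proof -
  obtain B where B: "\<And>x. x \<in> U \<Longrightarrow> L2_set x {..<n} \<le> B"
    using assms(1) unfolding bounded_Euclidean_def by blast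
  have "\<bar>x i\<bar> \<le> B" if "x \<in> U" for x
    using B[OF that] member_le_L2_set[of "{..<n}" i "\<lambda>i. \<bar>x i\<bar>"] assms(2)
    by (simp add: L2_set_def)
  then show ?thesis using that by blast
qed

lemma bounded_Euclidean_proj_first:
  assumes "bounded_Euclidean (Suc m) U"
  shows "bounded_Euclidean m (proj_first m ` U)"
proof -
  obtain B where B: "\<And>x. x \<in> U \<Longrightarrow> L2_set x {..<Suc m} \<le> B"
    using assms unfolding bounded_Euclidean_def by blast
  have "L2_set (proj_first m x) {..<m} \<le> B" if "x \<in> U" for x
  proof -
    have "L2_set (proj_first m x) {..<m} = L2_set x {..<m}"
      by (rule L2_set_cong) (auto simp: proj_first_def)
    also have "\<dots> \<le> L2_set x {..<Suc m}"
      unfolding L2_set_def by (intro real_sqrt_le_mono sum_mono2) auto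
    finally show ?thesis using B[OF that] by simp
  qed
  then show ?thesis unfolding bounded_Euclidean_def by blast
qed

section \<open>The recursive characterisation\<close>

text \<open>
  Intersections of the projection with coordinate conditions are projections of intersections of
  \<open>U\<close> with the same conditions and one more, on the last coordinate.
\<close>

lemma semi_monotone_projection:
  assumes "o_minimal_structure S" and U: "semi_monotone S (Suc m) U"
    and \<sigma>: "\<sigma> \<in> order_relations"
  shows "semi_monotone S m (proj_first m ` (U \<inter> coord_set (Suc m) m \<sigma> c))"
proof -
  interpret o_minimal_structure S by fact
  interpret algebra "topspace (Euclidean_space (Suc m))" "S (Suc m)" by (rule boolean_algebra)
  let ?W = "U \<inter> coord_set (Suc m) m \<sigma> c"
  have open_U: "openin (Euclidean_space (Suc m)) U"
    using U by (simp add: semi_monotone_def)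
  then have W: "?W \<subseteq> topspace (Euclidean_space (Suc m))"
    using openin_subset by blast
  have "proj_first m ` ?W \<in> S m"
    using U coord_set_definable[OF \<sigma>] by (intro projection Int) (auto simp: semi_monotone_def)
  moreover have "bounded_Euclidean m (proj_first m ` ?W)"
    using U by (intro bounded_Euclidean_proj_first)
      (auto simp: semi_monotone_def intro: bounded_Euclidean_mono)
  moreover have "connectedin (Euclidean_space m)
      (proj_first m ` ?W \<inter> (\<Inter>j\<in>J. coord_set m j (\<tau> j) (d j)))"
    if J: "J \<subseteq> {..<m}" and \<tau>: "\<forall>j\<in>J. \<tau> j \<in> order_relations" for J \<tau> d
  proof -
    let ?\<tau> = "\<tau>(m := \<sigma>)" and ?d = "d(m := c)"
    have "(\<Inter>j\<in>J. coord_set (Suc m) j (\<tau> j) (d j)) =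
        (\<Inter>j\<in>J. coord_set (Suc m) j (?\<tau> j) (?d j))"
      using J by (intro INF_cong) auto
    then have "?W \<inter> (\<Inter>j\<in>J. coord_set (Suc m) j (\<tau> j) (d j)) =
        U \<inter> (\<Inter>j\<in>insert m J. coord_set (Suc m) j (?\<tau> j) (?d j))"
      by (simp add: Int_assoc)
    moreover have "insert m J \<subseteq> {..<Suc m}" "\<forall>j\<in>insert m J. ?\<tau> j \<in> order_relations"
      using J \<tau> \<sigma> by auto
    ultimately have "connectedin (Euclidean_space (Suc m))
        (?W \<inter> (\<Inter>j\<in>J. coord_set (Suc m) j (\<tau> j) (d j)))"
      using U unfolding semi_monotone_def by metis
    from connectedin_continuous_map_image[OF continuous_map_proj_first this]
    show ?thesis
      unfolding lift_Inter_coord_set(2)[OF J W] .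
  qed
  ultimately show ?thesis
    unfolding semi_monotone_def using openin_proj_first_coord_set[OF open_U] by blast
qed

lemma open_connected_bounded_real:
  fixes T :: "real set"
  assumes "open T" "connected T" "T \<noteq> {}" and B: "\<And>r. r \<in> T \<Longrightarrow> \<bar>r\<bar> \<le> B"
  obtains s t where "s < t" "T = {s<..<t}"
proof -
  have bdd: "bdd_below T" "bdd_above T"
    using B by (force intro: bdd_belowI[of _ "-B"] bdd_aboveI[of _ B])+
  have "T = {Inf T<..<Sup T}"
  proof (intro equalityI subsetI)
    fix r assume r: "r \<in> T"
    obtain e where e: "e > 0" "cball r e \<subseteq> T"
      using \<open>open T\<close> r open_contains_cball by blast
    then have "r - e \<in> T" "r + e \<in> T" by (auto simp: dist_real_def subset_iff)
    then have "Inf T \<le> r - e" "r + e \<le> Sup T"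
      using bdd by (auto intro: cInf_lower cSup_upper)
    then show "r \<in> {Inf T<..<Sup T}" using e(1) by auto
  next
    fix r assume "r \<in> {Inf T<..<Sup T}"
    then obtain u v where "u \<in> T" "u < r" "v \<in> T" "r < v"
      using assms(3) bdd by (auto simp: cInf_less_iff less_cSup_iff)
    then show "r \<in> T"
      using \<open>connected T\<close> connectedD_interval[of T u v r] by auto
  qed
  moreover from this have "Inf T < Sup T" using assms(3) by force
  ultimately show ?thesis using that by blast
qed

text \<open>
  Fixing the first \<open>m\<close> coordinates cuts out a vertical section. Its set of heights is connected as
  a coordinate image, open since \<open>U\<close> is open, and bounded.
\<close>

lemma semi_monotone_imp_vertical_sections_intervals:
  assumes U: "semi_monotone S (Suc m) U"
  shows "vertical_sections_intervals (Suc m) U"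
  unfolding vertical_sections_intervals_def
proof (intro ballI)
  fix a assume a: "a \<in> topspace (Euclidean_space (Suc m))"
  let ?line = "\<lambda>r. a(m := r)"
  let ?T = "{r. ?line r \<in> U}"
  have open_U: "openin (Euclidean_space (Suc m)) U"
    using U by (simp add: semi_monotone_def)
  have section_T: "U \<inter> vertical_line (Suc m) a = ?line ` ?T"
    by (auto simp: vertical_line_def)
  have "U \<inter> vertical_line (Suc m) a = U \<inter> (\<Inter>j\<in>{..<m}. coord_set (Suc m) j (=) (a j))"
  proof (intro equalityI subsetI)
    fix x assume x: "x \<in> U \<inter> (\<Inter>j\<in>{..<m}. coord_set (Suc m) j (=) (a j))"
    then have "x \<in> topspace (Euclidean_space (Suc m))" using openin_subset[OF open_U] by auto
    have "x i = (a(m := x m)) i" for i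
    proof (cases "i < m")
      case True
      then show ?thesis using x by (auto simp: coord_set_def)
    next
      case False
      then show ?thesis
        using a \<open>x \<in> topspace _\<close> by (auto simp: topspace_Euclidean_space)
    qed
    then have "x = a(m := x m)" by (rule ext)
    then show "x \<in> U \<inter> vertical_line (Suc m) a"
      using x by (auto simp: vertical_line_def)
  qed (use openin_subset[OF open_U] in \<open>auto simp: coord_set_def vertical_line_def\<close>)
  moreover have "connectedin (Euclidean_space (Suc m))
      (U \<inter> (\<Inter>j\<in>{..<m}. coord_set (Suc m) j ((\<lambda>_. (=)) j) (a j)))"
    using U unfolding semi_monotone_def
    by (elim conjE allE[of _ "{..<m}"] allE[of _ "\<lambda>_. (=)"] allE[of _ a])
      (auto simp: order_relations_def)
  ultimately have "connectedin (Euclidean_space (Suc m)) (?line ` ?T)"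
    using section_T by simp
  then have "connectedin euclideanreal ((\<lambda>x. x m) ` ?line ` ?T)"
    by (rule connectedin_continuous_map_image[OF continuous_map_Euclidean_coordinate])
  then have "connected ?T" by (simp add: image_image)
  moreover have "open ?T"
    using openin_continuous_map_preimage[OF continuous_map_vertical_line[OF a] open_U] by simp
  moreover obtain B where "\<And>x. x \<in> U \<Longrightarrow> \<bar>x m\<bar> \<le> B"
    using bounded_Euclidean_coordinate[of "Suc m" U m] U by (auto simp: semi_monotone_def)
  then have "\<bar>r\<bar> \<le> B" if "r \<in> ?T" for r using that by fastforce
  ultimately have "?T = {} \<or> (\<exists>s t. s < t \<and> ?T = {s<..<t})"
    by (metis open_connected_bounded_real)
  then show "U \<inter> vertical_line (Suc m) a = {} \<or>
      (\<exists>s t. s < t \<and> U \<inter> vertical_line (Suc m) a = (\<lambda>r. a(Suc m - 1 := r)) ` {s<..<t})"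
    unfolding section_T by fastforce
qed

lemma semi_monotone_from_projections:
  assumes "U \<in> S (Suc m)" and open_U: "openin (Euclidean_space (Suc m)) U"
    and bounded: "bounded_Euclidean (Suc m) U"
    and sections: "vertical_sections_intervals (Suc m) U"
    and projections: "\<And>\<sigma> c. \<sigma> \<in> order_relations \<Longrightarrow>
      semi_monotone S m (proj_first m ` (U \<inter> coord_set (Suc m) m \<sigma> c))"
  shows "semi_monotone S (Suc m) U"
proof -
  have sub: "U \<subseteq> topspace (Euclidean_space (Suc m))" using openin_subset[OF open_U] .
  have with_last: "connectedin (Euclidean_space (Suc m))
      (U \<inter> coord_set (Suc m) m \<sigma> c \<inter> (\<Inter>j\<in>J. coord_set (Suc m) j (\<tau> j) (d j)))"
    if J: "J \<subseteq> {..<m}" and \<tau>: "\<forall>j\<in>J. \<tau> j \<in> order_relations" and \<sigma>: "\<sigma> \<in> order_relations"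
    for J \<tau> d \<sigma> c
  proof -
    let ?W = "U \<inter> coord_set (Suc m) m \<sigma> c"
    have "connectedin (Euclidean_space m)
        (proj_first m ` ?W \<inter> (\<Inter>j\<in>J. coord_set m j (\<tau> j) (d j)))"
      using projections[OF \<sigma>] J \<tau> unfolding semi_monotone_def by blast
    from connectedin_lift_from_projection[OF open_U sections \<sigma> this]
    show ?thesis using lift_Inter_coord_set(1)[OF J, of ?W \<tau> d] sub by fastforce
  qed
  obtain B where B: "\<And>x. x \<in> U \<Longrightarrow> \<bar>x m\<bar> \<le> B"
    using bounded_Euclidean_coordinate[OF bounded, of m] by blast
  \<comment> \<open>This cut lets an intersection without a condition on the last coordinate count as one with.\<close>
  have cut: "U \<inter> coord_set (Suc m) m (<) (B + 1) = U"
    using B sub by (fastforce simp: coord_set_def)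
  have "connectedin (Euclidean_space (Suc m))
      (U \<inter> (\<Inter>j\<in>J. coord_set (Suc m) j (\<tau> j) (d j)))"
    if J: "J \<subseteq> {..<Suc m}" and \<tau>: "\<forall>j\<in>J. \<tau> j \<in> order_relations" for J \<tau> d
  proof (cases "m \<in> J")
    case True
    then have "(\<Inter>j\<in>J. coord_set (Suc m) j (\<tau> j) (d j)) =
        (\<Inter>j\<in>insert m (J - {m}). coord_set (Suc m) j (\<tau> j) (d j))"
      by (simp only: insert_Diff)
    then have "U \<inter> (\<Inter>j\<in>J. coord_set (Suc m) j (\<tau> j) (d j)) =
        U \<inter> coord_set (Suc m) m (\<tau> m) (d m) \<inter>
          (\<Inter>j\<in>J - {m}. coord_set (Suc m) j (\<tau> j) (d j))"
      by (simp only: INT_insert Int_assoc)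
    moreover have "J - {m} \<subseteq> {..<m}" using J by (auto simp: less_Suc_eq)
    ultimately show ?thesis using with_last[of "J - {m}" \<tau> "\<tau> m" "d m" d] \<tau> True by simp
  next
    case False
    then have "J \<subseteq> {..<m}" using J by (auto simp: less_Suc_eq)
    then show ?thesis
      using with_last[of J \<tau> "(<)" "B + 1" d] \<tau> cut by (simp add: order_relations_def)
  qed
  then show ?thesis
    unfolding semi_monotone_def using assms(1) open_U bounded by blast
qed

theorem theorem1p3:
  fixes S :: "nat \<Rightarrow> (nat \<Rightarrow> real) set set" and n :: nat and U :: "(nat \<Rightarrow> real) set"
  assumes "o_minimal_structure S"
    and "n \<ge> 1"
    and "openin (Euclidean_space n) U"
    and "bounded_Euclidean n U"
    and "U \<in> S n"
  shows "semi_monotone S n U \<longleftrightarrow>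
           vertical_sections_intervals n U \<and>
           (\<forall>\<sigma> \<in> order_relations. \<forall>c.
              semi_monotone S (n - 1)
                (proj_first (n - 1) ` (U \<inter> coord_set n (n - 1) \<sigma> c)))"
proof -
  obtain m where n: "n = Suc m" using \<open>n \<ge> 1\<close> by (cases n) auto
  show ?thesis
    using assms semi_monotone_imp_vertical_sections_intervals[of S m U]
      semi_monotone_projection[of S m U] semi_monotone_from_projections[of U S m]
    unfolding n diff_Suc_1 by blast
qed

end
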